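(* There exist constants $0<c\le C$ such that for every integer $n\ge 3$, the complete graph $K_n$ admits a straight-line drawing whose total resolution $\rho$ satisfies $\frac{c}{n}\le \rho\le \frac{C}{n}$; that is, $K_n$ admits a drawing of total resolution $\Theta(\frac{1}{n})$.
   Context: A straight-line drawing of a graph maps the nodes to distinct points of the plane and each edge to the line segment joining the images of its endpoints (no edge passing through a node other than its endpoints). The angular resolution of a drawing is the smallest angle formed by two edges incident to a common node. The crossing resolution is the smallest angle formed at a crossing point of two crossing edges (of the two supplementary angles formed at a crossing, the smaller one); if the drawing has no crossings, the crossing resolution is taken to be $+\infty$. The total resolution of a drawing is the minimum of its angular resolution and its crossing resolution. *)

theory Defs
  imports "HOL-Analysis.Analysis" "HOL-Library.Ramsey"
begin

(* A simple graph is given by its node set V and its set E of edges, each edge a two-element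
   subset of V. The plane is the type complex with its Euclidean inner product and norm. *)

definition complete_edges :: "'a set \<Rightarrow> 'a set set" where
  "complete_edges V = [V]\<^bsup>2\<^esup>"

definition straight_line_drawing :: "'a set \<Rightarrow> 'a set set \<Rightarrow> ('a \<Rightarrow> complex) \<Rightarrow> bool" where
  "straight_line_drawing V E p \<longleftrightarrow>
     inj_on p V \<and>
     (\<forall>u v w. {u, v} \<in> E \<and> w \<in> V \<and> w \<notin> {u, v} \<longrightarrow> p w \<notin> closed_segment (p u) (p v))"

(* The angle a-x-b at the apex x, in [0, pi]; meaningful for a and b different from x. *)
definition angle_at :: "complex \<Rightarrow> complex \<Rightarrow> complex \<Rightarrow> real" where
  "angle_at a x b = arccos (((a - x) \<bullet> (b - x)) / (norm (a - x) * norm (b - x)))"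

(* Both resolutions take values in ereal, where the infimum of the empty set is infinity.
   For a finite graph the infima are minima. *)

definition angular_resolution :: "'a set set \<Rightarrow> ('a \<Rightarrow> complex) \<Rightarrow> ereal" where
  "angular_resolution E p =
     Inf {ereal (angle_at (p u) (p v) (p w)) | u v w.
            {v, u} \<in> E \<and> {v, w} \<in> E \<and> u \<noteq> w}"

(* At a crossing point x of the edges ab and cd, the angles a-x-c and a-x-d are supplementary.
   In a straight-line drawing, distinct edges with a common endpoint have disjoint open
   segments, so only edges with four different endpoints contribute. *)
definition crossing_resolution :: "'a set set \<Rightarrow> ('a \<Rightarrow> complex) \<Rightarrow> ereal" where
  "crossing_resolution E p =
     Inf {ereal (min (angle_at (p a) x (p c)) (angle_at (p a) x (p d))) | a b c d x.
            {a, b} \<in> E \<and> {c, d} \<in> E \<and> {a, b} \<noteq> {c, d} \<and>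
            x \<in> open_segment (p a) (p b) \<and> x \<in> open_segment (p c) (p d)}"

definition total_resolution :: "'a set set \<Rightarrow> ('a \<Rightarrow> complex) \<Rightarrow> ereal" where
  "total_resolution E p = min (angular_resolution E p) (crossing_resolution E p)"

end

(* The drawing is the regular n-gon. The chord joining the vertices a and b has direction
   i * cis ((a + b) * pi / n), so any two chords enclose an angle that is a multiple of pi / n.
   The angle is not 0 or pi, because no three points of the circle are collinear. *)
theory Submission
  imports Defs
begin

section \<open>Chords of the regular polygon and the angles between their directions\<close>

definition regular_polygon :: "nat \<Rightarrow> nat \<Rightarrow> complex" where
  "regular_polygon n k = cis (2 * (real k * pi / real n))"

lemma norm_regular_polygon [simp]: "norm (regular_polygon n k) = 1"
  by (simp add: regular_polygon_def)

text \<open>Sum-to-product formula. The doubled arguments avoid half angles and match the factor 2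
  placed outermost in \<open>regular_polygon\<close>.\<close>

lemma cis_chord: "cis (2 * x) - cis (2 * y) = (2 * sin (x - y)) *\<^sub>R (\<i> * cis (x + y))"
proof -
  have "cis (s + d) - cis (s - d) = (2 * sin d) *\<^sub>R (\<i> * cis s)" for s d
    by (simp add: complex_eq_iff cos_add cos_diff sin_add sin_diff)
  from this[of "x + y" "x - y"] show ?thesis
    by simp
qed

lemma inner_i_cis: "(\<i> * cis x) \<bullet> (\<i> * cis y) = cos (x - y)"
  by (simp add: inner_complex_def cos_diff)

text \<open>The indices are cast to \<open>int\<close> because their difference may be negative, and
  because parallelism of chords then becomes divisibility by \<open>n\<close>.\<close>

lemma regular_polygon_chord:
  "regular_polygon n a - regular_polygon n b =
     (2 * sin (real_of_int (int a - int b) * pi / real n)) *\<^sub>R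
       (\<i> * cis (real_of_int (int a + int b) * pi / real n))"
  unfolding regular_polygon_def cis_chord
  by (simp add: ring_distribs add_divide_distrib diff_divide_distrib)

text \<open>Adding a multiple of pi changes only the sign of the cosine, so \<open>m\<close> may be
  replaced by its remainder \<open>r\<close> modulo \<open>n\<close>. As \<open>r\<close> is between
  1 and \<open>n - 1\<close>, the argument lies between pi / n and pi - pi / n, where cosine is
  decreasing.\<close>

lemma abs_cos_multiple_le:
  fixes m :: int
  assumes "\<not> int n dvd m" and "n > 0"
  shows "\<bar>cos (real_of_int m * pi / real n)\<bar> \<le> cos (pi / real n)"
proof -
  define r where "r = m mod int n"
  have r: "1 \<le> r" "r \<le> int n - 1"
    using assms pos_mod_bound[of "int n" m] pos_mod_sign[of "int n" m]
    by (auto simp: r_def dvd_eq_mod_eq_0 simp del: pos_mod_bound pos_mod_sign)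
  have "m = r + int n * (m div int n)"
    by (simp add: r_def)
  then have "real_of_int m = real_of_int r + real n * real_of_int (m div int n)"
    by (metis of_int_add of_int_mult of_int_of_nat_eq)
  then have "real_of_int m * pi / real n =
      real_of_int r * pi / real n + real_of_int (m div int n) * pi"
    using \<open>n > 0\<close> by (simp add: field_simps)
  then have "\<bar>cos (real_of_int m * pi / real n)\<bar> = \<bar>cos (real_of_int r * pi / real n)\<bar>"
    using sin_times_pi_eq_0[of "real_of_int (m div int n)"]
    by (simp add: cos_add abs_mult mult.commute cos_int_times_real sin_int_times_real)
  moreover have "cos (real_of_int r * pi / real n) \<le> cos (pi / real n)"
  proof (rule cos_monotone_0_pi_le)
    show "pi / real n \<le> real_of_int r * pi / real n"
      using r \<open>n > 0\<close> by (simp add: divide_right_mono)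
    have "real_of_int r \<le> real n"
      using r by linarith
    then show "real_of_int r * pi / real n \<le> pi"
      using \<open>n > 0\<close> by (simp add: field_simps)
  qed simp
  moreover have "- cos (pi / real n) \<le> cos (real_of_int r * pi / real n)"
  proof -
    have "real_of_int r \<le> real n - 1"
      using r by linarith
    then have "real_of_int r * pi \<le> (real n - 1) * pi"
      by simp
    then have "real_of_int r * pi / real n \<le> pi - pi / real n"
      using \<open>n > 0\<close> by (simp add: field_simps)
    moreover have "0 \<le> real_of_int r * pi / real n"
      using r by simp
    ultimately have "cos (pi - pi / real n) \<le> cos (real_of_int r * pi / real n)"
      by (intro cos_monotone_0_pi_le) auto
    then show ?thesis by simp
  qed
  ultimately show ?thesis by linarith
qed

lemma sin_multiple_nonzero:
  fixes m :: int
  assumes "\<not> int n dvd m" and "n > 0"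
  shows "sin (real_of_int m * pi / real n) \<noteq> 0"
proof
  assume "sin (real_of_int m * pi / real n) = 0"
  then obtain i :: int where "real_of_int m * pi / real n = real_of_int i * pi"
    by (auto simp: sin_zero_iff_int2)
  then have "real_of_int m = real_of_int (i * int n)"
    using \<open>n > 0\<close> by (simp add: field_simps)
  then show False
    using assms by (metis dvd_triv_right of_int_eq_iff)
qed

lemma not_dvd_diff:
  fixes a b n :: nat
  assumes "a < n" "b < n" "a \<noteq> b"
  shows "\<not> int n dvd int a - int b"
  using assms zdvd_imp_le[of "int n" "int a - int b"] zdvd_imp_le[of "int n" "int b - int a"]
  by (cases "a < b") (auto simp: dvd_diff_commute)

lemma inj_on_regular_polygon: "inj_on (regular_polygon n) {..<n}"
proof (rule inj_onI, rule ccontr)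
  fix a b assume ab: "a \<in> {..<n}" "b \<in> {..<n}" "a \<noteq> b"
    "regular_polygon n a = regular_polygon n b"
  then show False
    using sin_multiple_nonzero[OF not_dvd_diff[of a n b]] regular_polygon_chord[of n a b] by auto
qed

text \<open>The sine factors of the chords can have either sign, which the absolute value absorbs.
  The bound is multiplied out instead of stated for a quotient: it then covers chords of length 0
  and can be rescaled to pieces of chords.\<close>

lemma abs_inner_chords_le:
  assumes "\<not> int n dvd (int a + int b) - (int c + int d)" and "n > 0"
  shows "\<bar>(regular_polygon n a - regular_polygon n b) \<bullet>
      (regular_polygon n c - regular_polygon n d)\<bar> \<le>
    cos (pi / real n) * (norm (regular_polygon n a - regular_polygon n b) *
      norm (regular_polygon n c - regular_polygon n d))"
proof -
  define x where "x = real_of_int (int a + int b) * pi / real n"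
  define y where "y = real_of_int (int c + int d) * pi / real n"
  have "x - y = real_of_int ((int a + int b) - (int c + int d)) * pi / real n"
    by (simp add: x_def y_def ring_distribs add_divide_distrib diff_divide_distrib)
  then have le: "\<bar>cos (x - y)\<bar> \<le> cos (pi / real n)"
    using abs_cos_multiple_le[OF assms] by simp
  have "\<bar>(s *\<^sub>R (\<i> * cis x)) \<bullet> (t *\<^sub>R (\<i> * cis y))\<bar> \<le>
      cos (pi / real n) * (norm (s *\<^sub>R (\<i> * cis x)) * norm (t *\<^sub>R (\<i> * cis y)))" for s t
    using mult_left_mono[OF le, of "\<bar>s\<bar> * \<bar>t\<bar>"]
    by (simp add: inner_i_cis abs_mult norm_mult mult_ac)
  then show ?thesis
    unfolding regular_polygon_chord x_def y_def by blast
qed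

lemma angle_at_ge:
  assumes "\<bar>(a - x) \<bullet> (b - x)\<bar> \<le> cos t * (norm (a - x) * norm (b - x))"
    and "a \<noteq> x" "b \<noteq> x" "0 \<le> t" "t \<le> pi"
  shows "t \<le> angle_at a x b"
proof -
  let ?N = "norm (a - x) * norm (b - x)"
  have N: "?N > 0"
    using assms by simp
  then have "\<bar>((a - x) \<bullet> (b - x)) / ?N\<bar> \<le> cos t"
    using assms(1) by (simp add: abs_divide abs_mult pos_divide_le_eq)
  \<comment> \<open>Arccos is decreasing on [-1, 1]; the two-sided bound also keeps the quotient at
    or above -1.\<close>
  then have "arccos (cos t) \<le> arccos (((a - x) \<bullet> (b - x)) / ?N)"
    using cos_le_one[of t] by (intro arccos_le_arccos) linarith+
  then show ?thesis
    using assms by (simp add: angle_at_def arccos_cos)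
qed

section \<open>The regular polygon as a straight-line drawing\<close>

lemma straight_line_drawing_regular_polygon:
  "straight_line_drawing {..<n} (complete_edges {..<n}) (regular_polygon n)"
  unfolding straight_line_drawing_def
proof (intro conjI allI impI)
  show "inj_on (regular_polygon n) {..<n}"
    by (rule inj_on_regular_polygon)
next
  fix u v w assume "{u, v} \<in> complete_edges {..<n} \<and> w \<in> {..<n} \<and> w \<notin> {u, v}"
  then have "regular_polygon n w \<notin> {regular_polygon n u, regular_polygon n v}"
    using inj_on_regular_polygon[of n]
    by (auto simp: complete_edges_def nsets_def dest: inj_onD)
  \<comment> \<open>An interior point of a chord is strictly closer to the centre 0 than one of the
    endpoints, whereas all vertices have distance 1 from it.\<close>
  moreover have "regular_polygon n w \<notin> open_segment (regular_polygon n u) (regular_polygon n v)"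
    by (auto dest!: dist_decreases_open_segment[where c = 0])
  ultimately show "regular_polygon n w \<notin> closed_segment (regular_polygon n u) (regular_polygon n v)"
    by (simp add: open_segment_def)
qed

section \<open>Crossing chords\<close>

lemma complete_edges_iff:
  "{u, v} \<in> complete_edges V \<longleftrightarrow> u \<in> V \<and> v \<in> V \<and> u \<noteq> v"
  by (auto simp: complete_edges_def nsets_def card_2_iff doubleton_eq_iff)

text \<open>A line with unit normal \<open>w\<close> meets the unit circle at most twice.
  Multiplication by \<open>cnj w\<close> rotates the line to the vertical line Re = h, on which the
  circle leaves only two opposite values for Im.\<close>

lemma unit_circle_two_points:
  fixes a b c w :: complex
  assumes "norm a = 1" "norm b = 1" "norm c = 1" "norm w = 1"
    and "a \<bullet> w = h" "b \<bullet> w = h" "c \<bullet> w = h" "a \<noteq> b"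
  shows "c = a \<or> c = b"
proof -
  have sq: "(Im (z * cnj w))\<^sup>2 = 1 - h\<^sup>2" and re: "Re (z * cnj w) = h"
    if "norm z = 1" "z \<bullet> w = h" for z
  proof -
    show re: "Re (z * cnj w) = h"
      using that by (simp add: inner_complex_def)
    have "norm (z * cnj w) = 1"
      using that assms by (simp add: norm_mult)
    then have "(Re (z * cnj w))\<^sup>2 + (Im (z * cnj w))\<^sup>2 = 1"
      by (metis cmod_power2 power_one)
    then show "(Im (z * cnj w))\<^sup>2 = 1 - h\<^sup>2"
      unfolding re by simp
  qed
  have w: "cnj w \<noteq> 0"
    using assms by auto
  have "Im (c * cnj w) = Im (a * cnj w) \<or> Im (c * cnj w) = - Im (a * cnj w)"
    using sq[of a] sq[of c] assms by (metis power2_eq_iff)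
  moreover have "Im (b * cnj w) = Im (a * cnj w) \<or> Im (b * cnj w) = - Im (a * cnj w)"
    using sq[of a] sq[of b] assms by (metis power2_eq_iff)
  \<comment> \<open>The real parts agree and \<open>a\<close> differs from \<open>b\<close>, so
    these two points already use up both signs.\<close>
  moreover have "Im (b * cnj w) \<noteq> Im (a * cnj w)"
    using re[of a] re[of b] assms w by (metis complex_eqI mult_right_cancel)
  ultimately have "Im (c * cnj w) = Im (a * cnj w) \<or> Im (c * cnj w) = Im (b * cnj w)"
    by auto
  then show ?thesis
    using re[of a] re[of b] re[of c] assms w by (metis complex_eqI mult_right_cancel)
qed

lemma inner_const_on_segment:
  fixes w :: "'a::real_inner"
  assumes "a \<bullet> w = b \<bullet> w" "x \<in> closed_segment a b"
  shows "x \<bullet> w = a \<bullet> w"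
proof -
  obtain t where "x = (1 - t) *\<^sub>R a + t *\<^sub>R b"
    using assms(2) by (auto simp: in_segment)
  then have "x \<bullet> w = (1 - t) * (a \<bullet> w) + t * (b \<bullet> w)"
    by (simp add: inner_left_distrib)
  then show ?thesis
    using assms(1) by (simp add: algebra_simps)
qed

text \<open>Parallel chords with a common point lie on one line, and this line meets the circle only
  in \<open>a\<close> and \<open>b\<close>. So both chords would have the same endpoints.\<close>

lemma crossing_chords_not_parallel:
  assumes "n > 0" and abcd: "a < n" "b < n" "c < n" "d < n"
    and "a \<noteq> b" "c \<noteq> d" "{a, b} \<noteq> {c, d}"
    and xab: "x \<in> closed_segment (regular_polygon n a) (regular_polygon n b)"
    and xcd: "x \<in> closed_segment (regular_polygon n c) (regular_polygon n d)"
  shows "\<not> int n dvd (int a + int b) - (int c + int d)"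
proof
  assume dvd: "int n dvd (int a + int b) - (int c + int d)"
  \<comment> \<open>The chord \<open>ab\<close> is a real multiple of \<open>\<i> * w\<close>, so
    \<open>w\<close> is a unit normal to it. By \<open>orth\<close> it is normal to
    \<open>cd\<close> too, whose direction can differ only in sign.\<close>
  define w where "w = cis (real_of_int (int a + int b) * pi / real n)"
  let ?p = "regular_polygon n"
  have orth: "?p e \<bullet> w = ?p f \<bullet> w" if "int n dvd (int a + int b) - (int e + int f)" for e f
  proof -
    from that obtain k where "(int a + int b) - (int e + int f) = int n * k"
      by (elim dvdE)
    then have "real_of_int (int a + int b) = real_of_int (int e + int f) + real n * real_of_int k"
      by (metis add.commute diff_eq_eq of_int_add of_int_mult of_int_of_nat_eq)
    then have "real_of_int (int a + int b) * pi / real n =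
        real_of_int (int e + int f) * pi / real n + real_of_int k * pi"
      using \<open>n > 0\<close> by (simp add: field_simps)
    moreover have "(\<i> * cis y) \<bullet> cis (y + real_of_int k * pi) = 0" for y
      using sin_int_times_real[of k]
      by (simp add: inner_complex_def cos_add sin_add algebra_simps)
    ultimately have "(?p e - ?p f) \<bullet> w = 0"
      unfolding regular_polygon_chord w_def by simp
    then show ?thesis
      by (simp add: inner_diff_left)
  qed
  have ab: "?p a \<bullet> w = ?p b \<bullet> w" and cd: "?p c \<bullet> w = ?p d \<bullet> w"
    using orth dvd by auto
  have "?p c \<bullet> w = ?p a \<bullet> w"
    using inner_const_on_segment[OF ab xab] inner_const_on_segment[OF cd xcd] by simp
  moreover have "?p a \<noteq> ?p b"
    using abcd \<open>a \<noteq> b\<close> inj_on_regular_polygon[of n] by (auto dest: inj_onD)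
  ultimately have "?p e = ?p a \<or> ?p e = ?p b" if "e \<in> {c, d}" for e
    using that ab cd by (intro unit_circle_two_points[of _ _ _ w]) (auto simp: w_def)
  then have "e = a \<or> e = b" if "e \<in> {c, d}" for e
    using that abcd inj_on_regular_polygon[of n] by (fastforce dest: inj_onD)
  then show False
    using \<open>c \<noteq> d\<close> \<open>{a, b} \<noteq> {c, d}\<close> by blast
qed

text \<open>Seen from an interior point, an endpoint lies in the direction of the whole segment;
  this transfers the bound on chords to the angle at a crossing.\<close>

lemma open_segment_diff:
  fixes a b x :: "'a::real_vector"
  assumes "x \<in> open_segment a b"
  obtains s where "s > 0" "a - x = s *\<^sub>R (a - b)"
proof -
  obtain s where "0 < s" "x = (1 - s) *\<^sub>R a + s *\<^sub>R b"
    using assms by (auto simp: in_segment)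
  then show ?thesis
    using that[of s] by (simp add: algebra_simps)
qed

lemma crossing_angle_ge:
  assumes "n > 0" and "{a, b} \<in> complete_edges {..<n}" "{c, d} \<in> complete_edges {..<n}"
    and "{a, b} \<noteq> {c, d}"
    and xab: "x \<in> open_segment (regular_polygon n a) (regular_polygon n b)"
    and xcd: "x \<in> open_segment (regular_polygon n c) (regular_polygon n d)"
  shows "pi / real n \<le> angle_at (regular_polygon n a) x (regular_polygon n c)"
proof -
  let ?p = "regular_polygon n"
  obtain s where s: "s > 0" "?p a - x = s *\<^sub>R (?p a - ?p b)"
    using open_segment_diff[OF xab] by metis
  obtain t where t: "t > 0" "?p c - x = t *\<^sub>R (?p c - ?p d)"
    using open_segment_diff[OF xcd] by metis
  have nd: "\<not> int n dvd (int a + int b) - (int c + int d)"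
    using assms by (intro crossing_chords_not_parallel[of n a b c d x])
      (auto simp: complete_edges_iff open_segment_def)
  have "\<bar>(?p a - x) \<bullet> (?p c - x)\<bar> \<le> cos (pi / real n) * (norm (?p a - x) * norm (?p c - x))"
    using mult_left_mono[OF abs_inner_chords_le[OF nd \<open>n > 0\<close>], of "s * t"] s(1) t(1)
    unfolding s(2) t(2) by (simp add: abs_mult mult_ac)
  then show ?thesis
    using xab xcd \<open>n > 0\<close> by (intro angle_at_ge) (auto simp: open_segment_def field_simps)
qed

section \<open>Lower bounds on the two resolutions\<close>

lemma crossing_resolution_regular_polygon_ge:
  assumes "n > 0"
  shows "ereal (pi / real n) \<le> crossing_resolution (complete_edges {..<n}) (regular_polygon n)"
  unfolding crossing_resolution_def
proof (rule Inf_greatest, clarify)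
  fix a b c d x
  let ?p = "regular_polygon n"
  assume "{a, b} \<in> complete_edges {..<n}" "{c, d} \<in> complete_edges {..<n}" "{a, b} \<noteq> {c, d}"
    "x \<in> open_segment (?p a) (?p b)" "x \<in> open_segment (?p c) (?p d)"
  then show "ereal (pi / real n) \<le> ereal (min (angle_at (?p a) x (?p c)) (angle_at (?p a) x (?p d)))"
    \<comment> \<open>Exchanging \<open>c\<close> and \<open>d\<close> yields the supplementary
      angle.\<close>
    using crossing_angle_ge[OF assms, of a b c d x] crossing_angle_ge[OF assms, of a b d c x]
    by (simp add: insert_commute open_segment_commute)
qed

lemma angular_resolution_regular_polygon_ge:
  assumes "n > 0"
  shows "ereal (pi / real n) \<le> angular_resolution (complete_edges {..<n}) (regular_polygon n)"
  unfolding angular_resolution_def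
proof (rule Inf_greatest, clarify)
  fix u v w
  let ?p = "regular_polygon n"
  assume "{v, u} \<in> complete_edges {..<n}" "{v, w} \<in> complete_edges {..<n}" and "u \<noteq> w"
  then have uvw: "u < n" "v < n" "w < n" "v \<noteq> u" "v \<noteq> w"
    by (auto simp: complete_edges_iff)
  \<comment> \<open>The shared endpoint \<open>v\<close> cancels, leaving the difference of two
    distinct indices below \<open>n\<close>.\<close>
  then have "\<not> int n dvd (int u + int v) - (int w + int v)"
    using not_dvd_diff[of u n w] \<open>u \<noteq> w\<close> by simp
  from abs_inner_chords_le[OF this assms]
  show "ereal (pi / real n) \<le> ereal (angle_at (?p u) (?p v) (?p w))"
    using uvw assms inj_on_regular_polygon[of n]
    by (simp, intro angle_at_ge) (auto simp: divide_le_eq dest: inj_onD)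
qed

section \<open>An angle that attains the lower bound\<close>

lemma angle_at_regular_polygon_012:
  assumes "n \<ge> 3"
  shows "angle_at (regular_polygon n 1) (regular_polygon n 0) (regular_polygon n 2) = pi / real n"
proof -
  \<comment> \<open>Both chord factors are positive, so they cancel against the norms without a
    change of sign. The second one needs 2 * pi / n < pi, hence n \<ge> 3. What remains is the
    inscribed angle over one side of the polygon.\<close>
  have "sin (pi / real n) > 0" "sin (2 * pi / real n) > 0"
    using assms by (auto intro!: sin_gt_zero simp: field_simps)
  moreover have "pi / real n - 2 * pi / real n = - (pi / real n)"
    by (simp add: field_simps)
  ultimately have "angle_at (regular_polygon n 1) (regular_polygon n 0) (regular_polygon n 2) =
      arccos (cos (pi / real n))"
    unfolding angle_at_def regular_polygon_chord
    by (simp add: inner_i_cis norm_mult)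
  then show ?thesis
    using assms by (simp add: arccos_cos field_simps)
qed

lemma angular_resolution_regular_polygon_le:
  assumes "n \<ge> 3"
  shows "angular_resolution (complete_edges {..<n}) (regular_polygon n) \<le> ereal (pi / real n)"
  unfolding angular_resolution_def
proof (rule Inf_lower, clarify)
  have "{0, 1} \<in> complete_edges {..<n}" "{0, 2} \<in> complete_edges {..<n}"
    using assms by (auto simp: complete_edges_iff)
  then show "\<exists>u v w. ereal (pi / real n) =
      ereal (angle_at (regular_polygon n u) (regular_polygon n v) (regular_polygon n w)) \<and>
      {v, u} \<in> complete_edges {..<n} \<and> {v, w} \<in> complete_edges {..<n} \<and> u \<noteq> w"
    using angle_at_regular_polygon_012[OF assms]
    by (intro exI[of _ 1] exI[of _ 0] exI[of _ 2]) simp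
qed

theorem theorem1:
  shows "\<exists>c C :: real. 0 < c \<and> c \<le> C \<and>
    (\<forall>n::nat. n \<ge> 3 \<longrightarrow>
      (\<exists>p :: nat \<Rightarrow> complex.
        straight_line_drawing {..<n} (complete_edges {..<n}) p \<and>
        ereal (c / real n) \<le> total_resolution (complete_edges {..<n}) p \<and>
        total_resolution (complete_edges {..<n}) p \<le> ereal (C / real n)))"
proof (intro exI conjI allI impI)
  fix n :: nat assume "n \<ge> 3"
  \<comment> \<open>These claims instantiate both constants to \<open>pi\<close>: the total
    resolution is exactly pi / n. Since it is a minimum, its upper bound follows from the angular
    resolution alone.\<close>
  then show "straight_line_drawing {..<n} (complete_edges {..<n}) (regular_polygon n)"
    and "ereal (pi / real n) \<le> total_resolution (complete_edges {..<n}) (regular_polygon n)"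
    and "total_resolution (complete_edges {..<n}) (regular_polygon n) \<le> ereal (pi / real n)"
    using straight_line_drawing_regular_polygon angular_resolution_regular_polygon_ge[of n]
      angular_resolution_regular_polygon_le[of n] crossing_resolution_regular_polygon_ge[of n]
    by (auto simp: total_resolution_def min.coboundedI1)
qed auto

end
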